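(* Let $\xi:I\to\mathbb Z$ be a height function, $I=\{1,\dots,n\}$. Let $j\in I$ with $j<n$ be a source or sink, and let $i\in I$ with $i<j$. Then in the cluster algebra $\mathcal A(\widetilde{\mathbf x},Q_\xi)$ $$x[\alpha_{i,j}]\,x[\alpha_{j+1,j+1}]=x[\alpha_{i,j+1}]+x[\alpha_{i,\max\{i-1,j_\bullet-1\}}]^{1-\delta_{i,j_\bullet}}\,\bigl(x'_{\max\{i,j_\bullet\}}\bigr)^{\min\{1,\,(1-\delta_{j_\bullet,i_\bullet})d_{j_\bullet-1}+\delta_{j_\bullet,i}\}}\,x[-\alpha_{j+2}]^{d_{j+1}}\,(x'_{j+2})^{1-d_{j+1}},$$ where $\delta$ is the Kronecker symbol and $d_m=\delta_{m,m_\diamond}$.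
   Context: A height function is $\xi:I\to\mathbb Z$ with $|\xi(i)-\xi(i+1)|=1$ for $1\le i\le n-1$, extended by $\xi(0)=\xi(2)$, $\xi(n+1)=\xi(n-1)$. For $i<n$, $i_\diamond=\min\{\ell\in[i,n]:\xi(\ell)=\xi(\ell+2)\}$, and $n_\diamond=n$. A vertex $i\in I$ is called a source or sink if $i=n$ or $\xi(i)=\xi(i+2)$ (frozen vertices are ignored). For $1\le j\le 1_\diamond$ put $j_\bullet=0$, and for $j>1_\diamond$ let $j_\bullet$ be the maximal source or sink with $j_\bullet<j$. The quiver $Q_\xi$ has mutable vertices $I$ and frozen vertices $1',\dots,n'$. For each $i\in I$ with $\xi(i)=\xi(i+1)+1$ it has arrows $i\to i-1$, $i'\to i$, and: if $i=i_\diamond$, $i\to i+1$; if $i\ne i_\diamond$, $i+1\to i$ and $i\to(i+1)'$. If $\xi(i)=\xi(i+1)-1$, all these arrows are reversed. Arrows involving $0$ or $n+1$ are omitted, and an arrow described twice is taken once. $\mathcal A(\widetilde{\mathbf x},Q_\xi)$ is the cluster algebra with initial seed $(\{x_1,\dots,x_n,x_1',\dots,x_n'\},Q_\xi)$, $x_i'$ being the frozen variable at $i'$; exchange relations are $x_kx_k^{new}=\prod_{u\to k}x_u+\prod_{k\to u}x_u$. $\alpha_1,\dots,\alpha_n$ are simple roots of type $A_n$, $\alpha_{i,j}=\alpha_i+\cdots+\alpha_j$. Write $x[-\alpha_i]=x_i$; for $1\le i\le j\le n$, $x[\alpha_{i,j}]$ is the cluster variable at vertex $j$ obtained from the initial seed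 by mutating successively at $i,i+1,\dots,j$ (its denominator is $x_i\cdots x_j$). Conventions: $x[\alpha_{i,i-1}]=x[-\alpha_{i-1}]=x_{i-1}$, $x_0=1$, $x[-\alpha_{n+1}]=x_{n+1}=1$, $x'_{n+1}=1$, and $d_m=0$ for $m\le0$. *)

theory Defs
  imports
    Complex_Main
    "HOL-Library.Poly_Mapping"
    "HOL-Computational_Algebra.Fraction_Field"
begin

section \<open>Vertices and the ambient field\<close>

text \<open>\<open>Mut i\<close> is the mutable vertex $i$, \<open>Frz i\<close> the frozen vertex $i'$.\<close>

datatype vertex = Mut nat | Frz nat

text \<open>
  The linear order on vertices has no mathematical content: the library makes polynomials over
  ordered monomials an integral domain, and the fraction field needs that instance.
\<close>

fun vertex_rank :: "vertex \<Rightarrow> nat" where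
  "vertex_rank (Mut i) = 2 * i"
| "vertex_rank (Frz i) = 2 * i + 1"

lemma vertex_rank_inject: "vertex_rank u = vertex_rank v \<Longrightarrow> u = v"
  by (cases u; cases v) (simp_all, presburger+)

instantiation vertex :: linorder
begin

definition less_eq_vertex :: "vertex \<Rightarrow> vertex \<Rightarrow> bool" where
  "u \<le> v \<longleftrightarrow> vertex_rank u \<le> vertex_rank v"

definition less_vertex :: "vertex \<Rightarrow> vertex \<Rightarrow> bool" where
  "u < v \<longleftrightarrow> vertex_rank u < vertex_rank v"

instance
  by standard (auto simp: less_eq_vertex_def less_vertex_def intro: vertex_rank_inject)

end

text \<open>
  Rational functions over $\mathbb{Q}$ in one indeterminate per vertex.  For a given $n$ only the
  indeterminates at the vertices in \<open>vertices n\<close> below occur.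
\<close>

type_synonym ratfun = "((vertex \<Rightarrow>\<^sub>0 nat) \<Rightarrow>\<^sub>0 rat) fract"

definition indet :: "vertex \<Rightarrow> ratfun" where
  "indet v = Fract (Poly_Mapping.single (Poly_Mapping.single v 1) 1) 1"

definition vertices :: "nat \<Rightarrow> vertex set" where
  "vertices n = Mut ` {1..n} \<union> Frz ` {1..n}"

section \<open>Seeds, mutation and the cluster algebra\<close>

text \<open>\<open>quiver S u v\<close> is the number of arrows from \<open>u\<close> to \<open>v\<close>.\<close>

record seed =
  cluster :: "vertex \<Rightarrow> ratfun"
  quiver :: "vertex \<Rightarrow> vertex \<Rightarrow> nat"

text \<open>
  The truncated subtraction cancels 2-cycles after the composite arrows through \<open>k\<close> have been
  added.  Arrows between two frozen vertices are not discarded: they never enter an exchange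
  relation, and never affect the other arrows, since one only mutates at mutable vertices.
\<close>

definition mutate_quiver ::
    "vertex \<Rightarrow> (vertex \<Rightarrow> vertex \<Rightarrow> nat) \<Rightarrow> vertex \<Rightarrow> vertex \<Rightarrow> nat" where
  "mutate_quiver k Q u v =
     (if u = k \<or> v = k then Q v u
      else (Q u v + Q u k * Q k v) - (Q v u + Q v k * Q k u))"

definition mutate_seed :: "nat \<Rightarrow> vertex \<Rightarrow> seed \<Rightarrow> seed" where
  "mutate_seed n k S =
     \<lparr> cluster = (cluster S)
         (k := ((\<Prod>u\<in>vertices n. cluster S u ^ quiver S u k)
              + (\<Prod>u\<in>vertices n. cluster S u ^ quiver S k u)) / cluster S k),
       quiver = mutate_quiver k (quiver S) \<rparr>"

inductive_set mutation_class :: "nat \<Rightarrow> seed \<Rightarrow> seed set" for n :: nat and S\<^sub>0 :: seed where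
  initial: "S\<^sub>0 \<in> mutation_class n S\<^sub>0"
| mutate: "S \<in> mutation_class n S\<^sub>0 \<Longrightarrow> k \<in> {1..n} \<Longrightarrow>
    mutate_seed n (Mut k) S \<in> mutation_class n S\<^sub>0"

text \<open>
  The subring generated by all cluster variables and frozen variables; the frozen variables are
  not inverted.
\<close>

inductive_set cluster_algebra :: "nat \<Rightarrow> seed \<Rightarrow> ratfun set" for n :: nat and S\<^sub>0 :: seed where
  generator: "S \<in> mutation_class n S\<^sub>0 \<Longrightarrow> v \<in> vertices n \<Longrightarrow>
    cluster S v \<in> cluster_algebra n S\<^sub>0"
| one: "1 \<in> cluster_algebra n S\<^sub>0"
| diff: "a \<in> cluster_algebra n S\<^sub>0 \<Longrightarrow> b \<in> cluster_algebra n S\<^sub>0 \<Longrightarrow>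
    a - b \<in> cluster_algebra n S\<^sub>0"
| mult: "a \<in> cluster_algebra n S\<^sub>0 \<Longrightarrow> b \<in> cluster_algebra n S\<^sub>0 \<Longrightarrow>
    a * b \<in> cluster_algebra n S\<^sub>0"

section \<open>Height functions\<close>

text \<open>
  A height function on $I = \{1,\dots,n\}$ is a function on all naturals of which only the values
  on $I$ are used; \<open>hext n \<xi>\<close> is its extension to $\{0,\dots,n+1\}$.
\<close>

definition height_function :: "nat \<Rightarrow> (nat \<Rightarrow> int) \<Rightarrow> bool" where
  "height_function n \<xi> \<longleftrightarrow> (\<forall>i. 1 \<le> i \<and> i < n \<longrightarrow> \<bar>\<xi> i - \<xi> (i + 1)\<bar> = 1)"

definition hext :: "nat \<Rightarrow> (nat \<Rightarrow> int) \<Rightarrow> nat \<Rightarrow> int" where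
  "hext n \<xi> m = (if m = 0 then \<xi> 2 else if m = n + 1 then \<xi> (n - 1) else \<xi> m)"

text \<open>
  In $i_\diamond$ the index $\ell = n$ is left out, because $\xi(n+2)$ is not defined.  This does
  not change the minimum: $\ell = n-1$ always qualifies, as $\xi(n+1) = \xi(n-1)$.
\<close>

definition diamond :: "nat \<Rightarrow> (nat \<Rightarrow> int) \<Rightarrow> nat \<Rightarrow> nat" where
  "diamond n \<xi> i = (if i < n then Min {l \<in> {i..<n}. hext n \<xi> l = hext n \<xi> (l + 2)} else n)"

definition source_or_sink :: "nat \<Rightarrow> (nat \<Rightarrow> int) \<Rightarrow> nat \<Rightarrow> bool" where
  "source_or_sink n \<xi> i \<longleftrightarrow> i \<in> {1..n} \<and> (i = n \<or> hext n \<xi> i = hext n \<xi> (i + 2))"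

definition bullet :: "nat \<Rightarrow> (nat \<Rightarrow> int) \<Rightarrow> nat \<Rightarrow> nat" where
  "bullet n \<xi> j =
     (if j \<le> diamond n \<xi> 1 then 0 else Max {l. source_or_sink n \<xi> l \<and> l < j})"

section \<open>The quiver of a height function and its initial seed\<close>

text \<open>The arrows contributed by $i$ when $\xi(i) = \xi(i+1)+1$.\<close>

definition local_arrows :: "nat \<Rightarrow> (nat \<Rightarrow> int) \<Rightarrow> nat \<Rightarrow> (vertex \<times> vertex) set" where
  "local_arrows n \<xi> i =
     {(Mut i, Mut (i - 1)), (Frz i, Mut i)} \<union>
     (if i = diamond n \<xi> i then {(Mut i, Mut (i + 1))}
      else {(Mut (i + 1), Mut i), (Mut i, Frz (i + 1))})"

text \<open>
  Taking a set of arrows identifies arrows that are described twice; the intersection removes the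
  arrows involving $0$ or $n+1$.
\<close>

definition height_arrows :: "nat \<Rightarrow> (nat \<Rightarrow> int) \<Rightarrow> (vertex \<times> vertex) set" where
  "height_arrows n \<xi> =
     ((\<Union>i\<in>{i \<in> {1..n}. hext n \<xi> i = hext n \<xi> (i + 1) + 1}. local_arrows n \<xi> i) \<union>
      (\<Union>i\<in>{i \<in> {1..n}. hext n \<xi> i = hext n \<xi> (i + 1) - 1}. (local_arrows n \<xi> i)\<inverse>))
     \<inter> vertices n \<times> vertices n"

definition height_seed :: "nat \<Rightarrow> (nat \<Rightarrow> int) \<Rightarrow> seed" where
  "height_seed n \<xi> =
     \<lparr> cluster = indet,
       quiver = (\<lambda>u v. if (u, v) \<in> height_arrows n \<xi> then 1 else 0) \<rparr>"

section \<open>Cluster variables attached to roots\<close>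

text \<open>$x[-\alpha_i] = x_i$, with $x_0 = x_{n+1} = 1$.\<close>

definition x_neg :: "nat \<Rightarrow> nat \<Rightarrow> ratfun" where
  "x_neg n i = (if i = 0 \<or> i = n + 1 then 1 else indet (Mut i))"

text \<open>$x'_i$, with $x'_{n+1} = 1$.\<close>

definition x_frz :: "nat \<Rightarrow> nat \<Rightarrow> ratfun" where
  "x_frz n i = (if i = n + 1 then 1 else indet (Frz i))"

text \<open>
  $x[\alpha_{i,j}]$: the variable at $j$ after mutating first at $i$, then at $i+1$, and so on up
  to $j$; and $x[\alpha_{i,i-1}] = x[-\alpha_{i-1}]$.
\<close>

definition x_pos :: "nat \<Rightarrow> (nat \<Rightarrow> int) \<Rightarrow> nat \<Rightarrow> nat \<Rightarrow> ratfun" where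
  "x_pos n \<xi> i j =
     (if j + 1 = i then x_neg n (i - 1)
      else cluster (fold (\<lambda>k. mutate_seed n (Mut k)) [i..<j + 1] (height_seed n \<xi>)) (Mut j))"

definition kdelta :: "nat \<Rightarrow> nat \<Rightarrow> nat" where
  "kdelta a b = (if a = b then 1 else 0)"

text \<open>
  $d_m = \delta_{m,m_\diamond}$ for $m \geq 1$.  The convention $d_m = 0$ for $m \leq 0$ reduces to
  $d_0 = 0$, since truncated subtraction turns the only possible negative index, $-1$, into $0$.
\<close>

definition d_ind :: "nat \<Rightarrow> (nat \<Rightarrow> int) \<Rightarrow> nat \<Rightarrow> nat" where
  "d_ind n \<xi> m = (if m = 0 then 0 else kdelta m (diamond n \<xi> m))"

end

theory Submission
  imports Defs
begin

text \<open>
  Fix \<open>i\<close> and mutate the initial seed successively at \<open>i, i + 1, \<dots>\<close>.  The exchange relation at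
  \<open>k\<close> only depends on the arrows incident to \<open>k\<close> just before \<open>k\<close> is mutated, and these obey a
  simple recursion.  As long as only vertices below \<open>k\<close> have been mutated, the arrows at \<open>k + 1\<close>
  are the initial ones (\<open>later_column_seed_at\<close>), so the mutation at \<open>k\<close> changes them for the first
  time.  It reverses the arrow between \<open>k\<close> and \<open>k + 1\<close> and adds composite arrows through \<open>k\<close>, that
  is, it hands the neighbours of \<open>k\<close> on one side over to \<open>k + 1\<close>.  Which side depends on whether
  \<open>\<xi>\<close> turns at \<open>k\<close>: this is where sources and sinks come in.  Solving the recursion
  (\<open>column_seed_at\<close>) shows that, for \<open>k > i\<close>, the neighbours of \<open>k\<close> at lower positions on the side
  opposite to \<open>k - 1\<close> are inherited from step to step until a source or sink is passed, and are then
  replaced by those on the other side.  Hence they are determined by \<open>i\<close> and the last source or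
  sink $k_\bullet$ before \<open>k\<close>.

  Writing \<open>X\<^sub>k\<close> for $x[\alpha_{i,k}]$, this gives for \<open>i \<le> k\<close> (\<open>exchange_relation\<close>)
  \[ X_k x_k = H_k \, x_{k+1}^{1-d_k} + F_k \, x_{k+1}^{d_k} (x'_{k+1})^{1-d_k}, \]
  where $H_i = x'_i$ and $H_k = X_{k-1} (x'_k)^{d_{k-1}}$ for \<open>k > i\<close>, while $F_k = x_{i-1}$ if
  $k_\bullet < i$ and $F_k = H_{k_\bullet}$ otherwise.  The factor multiplying the powers of
  $x_{j+2}$ and $x'_{j+2}$ in the claim is exactly $F_j$ (\<open>x_head_neg_eq\<close>).

  Now let \<open>j\<close> be a source or sink, so that $d_j = 1$ and $(j+1)_\bullet = j$.  Put
  $Y = x[\alpha_{j+1,j+1}]$, $p = x_{j+2}^{1-d_{j+1}}$ and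
  $q = x_{j+2}^{d_{j+1}} (x'_{j+2})^{1-d_{j+1}}$.  The three relations
  \[ X_j x_j = H_j + F_j x_{j+1}, \quad X_{j+1} x_{j+1} = X_j x'_{j+1} p + H_j q, \quad
     Y x_{j+1} = x'_{j+1} p + x_j q \]
  yield $X_j Y x_{j+1} = X_j x'_{j+1} p + (H_j + F_j x_{j+1}) q = (X_{j+1} + F_j q) x_{j+1}$, and
  cancelling $x_{j+1}$ gives the claim.  The product lies in the cluster algebra because both
  factors are cluster variables.
\<close>

section \<open>Sources and sinks\<close>

text \<open>
  The height function goes down from \<open>i\<close> to \<open>i + 1\<close>.  The arrows contributed by \<open>i\<close> have the
  orientation of \<open>local_arrows\<close> at a descent and are reversed otherwise.
\<close>

definition descent :: "nat \<Rightarrow> (nat \<Rightarrow> int) \<Rightarrow> nat \<Rightarrow> bool" where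
  "descent n \<xi> i \<longleftrightarrow> hext n \<xi> i = hext n \<xi> (i + 1) + 1"

lemma hext_step:
  assumes "height_function n \<xi>" "2 \<le> n" "1 \<le> i" "i \<le> n"
  shows "\<bar>hext n \<xi> i - hext n \<xi> (i + 1)\<bar> = 1"
proof (cases "i = n")
  case True
  have "\<bar>\<xi> (n - 1) - \<xi> (n - 1 + 1)\<bar> = 1"
    using assms(2) by (intro assms(1)[unfolded height_function_def, rule_format]) auto
  with True assms show ?thesis by (simp add: hext_def)
next
  case False
  with assms show ?thesis by (auto simp: hext_def height_function_def)
qed

lemma ascent_iff:
  assumes "height_function n \<xi>" "2 \<le> n" "1 \<le> i" "i \<le> n"
  shows "hext n \<xi> i = hext n \<xi> (i + 1) - 1 \<longleftrightarrow> \<not> descent n \<xi> i"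
  using hext_step[OF assms] by (auto simp: descent_def)

lemma source_or_sink_iff_turn:
  assumes "height_function n \<xi>" "2 \<le> n" "1 \<le> i" "i < n"
  shows "source_or_sink n \<xi> i \<longleftrightarrow> descent n \<xi> (i + 1) \<noteq> descent n \<xi> i"
proof -
  have "source_or_sink n \<xi> i \<longleftrightarrow> hext n \<xi> i = hext n \<xi> (i + 2)"
    using assms by (simp add: source_or_sink_def)
  moreover have "i + 1 + 1 = i + 2" by simp
  ultimately show ?thesis
    using hext_step[OF assms(1,2), of i] hext_step[OF assms(1,2), of "i + 1"] assms(3,4)
    by (auto simp: descent_def)
qed

lemma diamond_in:
  assumes "2 \<le> n" "i < n"
  shows "diamond n \<xi> i \<in> {l \<in> {i..<n}. hext n \<xi> l = hext n \<xi> (l + 2)}" (is "_ \<in> ?A")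
proof -
  have "n - 1 \<in> ?A" using assms by (auto simp: hext_def)
  then have "?A \<noteq> {}" by blast
  then have "Min ?A \<in> ?A" by (intro Min_in) auto
  then show ?thesis using assms by (simp add: diamond_def)
qed

lemma diamond_le:
  assumes "1 \<le> i" "i \<le> l" "l < n" "source_or_sink n \<xi> l"
  shows "diamond n \<xi> i \<le> l"
  using assms by (auto simp: diamond_def source_or_sink_def)

lemma source_or_sink_diamond:
  assumes "2 \<le> n" "1 \<le> i" "i \<le> n"
  shows "source_or_sink n \<xi> (diamond n \<xi> i)" "i \<le> diamond n \<xi> i"
  using assms diamond_in[of n i \<xi>]
  by (cases "i = n"; force simp: diamond_def source_or_sink_def)+

lemma diamond_eq_iff:
  assumes "2 \<le> n" "1 \<le> i" "i \<le> n"
  shows "i = diamond n \<xi> i \<longleftrightarrow> source_or_sink n \<xi> i"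
proof
  assume "source_or_sink n \<xi> i"
  then show "i = diamond n \<xi> i"
    using diamond_le[of i i n \<xi>] source_or_sink_diamond(2)[OF assms, of \<xi>] assms
    by (cases "i = n") (auto simp: diamond_def)
qed (metis source_or_sink_diamond(1)[OF assms])

lemma d_ind_eq:
  assumes "2 \<le> n" "1 \<le> i" "i \<le> n"
  shows "d_ind n \<xi> i = of_bool (source_or_sink n \<xi> i)"
  using diamond_eq_iff[OF assms, of \<xi>] assms by (simp add: d_ind_def kdelta_def)

lemma bullet_eq_0:
  assumes "2 \<le> n" "\<And>l. 1 \<le> l \<Longrightarrow> l < k \<Longrightarrow> \<not> source_or_sink n \<xi> l"
  shows "bullet n \<xi> k = 0"
proof -
  have "k \<le> diamond n \<xi> 1"
    using assms source_or_sink_diamond[of n 1 \<xi>] by (meson le_less_linear le_trans one_le_numeral order_refl)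
  then show ?thesis by (simp add: bullet_def)
qed

lemma bullet_eq_Max:
  assumes "k \<le> n" "source_or_sink n \<xi> l" "l < k"
  shows "bullet n \<xi> k = Max {l. source_or_sink n \<xi> l \<and> l < k}"
proof -
  have "1 \<le> l" using assms(2) by (simp add: source_or_sink_def)
  then have "\<not> k \<le> diamond n \<xi> 1"
    using diamond_le[of 1 l n \<xi>] assms by simp
  then show ?thesis by (simp add: bullet_def)
qed

lemma bullet_1: "2 \<le> n \<Longrightarrow> bullet n \<xi> 1 = 0"
  by (rule bullet_eq_0) auto

text \<open>
  The recursion by which $k_\bullet$ enters: passing a source or sink resets it, passing any other
  vertex keeps it.
\<close>

lemma bullet_Suc:
  assumes "2 \<le> n" "1 \<le> k" "k < n"
  shows "bullet n \<xi> (k + 1) = (if source_or_sink n \<xi> k then k else bullet n \<xi> k)"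
proof (cases "source_or_sink n \<xi> k")
  case True
  then have "bullet n \<xi> (k + 1) = Max {l. source_or_sink n \<xi> l \<and> l < k + 1}"
    using assms by (intro bullet_eq_Max[of "k + 1" n \<xi> k]) auto
  also have "\<dots> = k" using True by (intro Max_eqI) auto
  finally show ?thesis using True by simp
next
  case False
  have eq: "{l. source_or_sink n \<xi> l \<and> l < k + 1} = {l. source_or_sink n \<xi> l \<and> l < k}"
    using False by (auto simp: less_Suc_eq)
  show ?thesis
  proof (cases "\<exists>l<k. source_or_sink n \<xi> l")
    case True
    then obtain l where "l < k" "source_or_sink n \<xi> l" by blast
    then show ?thesis
      using False eq assms bullet_eq_Max[of k n \<xi> l] bullet_eq_Max[of "k + 1" n \<xi> l] by auto
  next
    case no: False
    then show ?thesis
      using False assms bullet_eq_0[of n k \<xi>] bullet_eq_0[of n "k + 1" \<xi>] by (auto simp: less_Suc_eq)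
  qed
qed

lemma bullet_less:
  assumes "2 \<le> n" "1 \<le> k" "k \<le> n"
  shows "bullet n \<xi> k < k"
  using assms(2,3)
proof (induction k rule: dec_induct)
  case base
  then show ?case using bullet_1[of n \<xi>] assms by simp
next
  case (step k)
  then show ?case using bullet_Suc[of n k \<xi>] assms by auto
qed

lemma bullet_eq_if_less:
  assumes "2 \<le> n" "1 \<le> i" "i \<le> k" "k \<le> n" "bullet n \<xi> k < i"
  shows "bullet n \<xi> k = bullet n \<xi> i"
  using assms(3-5)
proof (induction k rule: dec_induct)
  case (step k)
  then show ?case using bullet_Suc[of n k \<xi>] assms(1,2) by (auto split: if_splits)
qed simp

section \<open>Columns of the quiver\<close>

text \<open>
  The arrows between \<open>v\<close> and the vertices of the quiver are simple; they enter \<open>v\<close> from \<open>P\<close> and leave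
  \<open>v\<close> towards \<open>N\<close>, or the reverse if \<open>t\<close> is false.  The flag absorbs the global sign by which the
  arrows at a descent and at an ascent differ.  The sets \<open>P\<close> and \<open>N\<close> may contain elements
  outside \<open>vertices n\<close>, which have no effect; so neighbours at the positions \<open>0\<close> and \<open>n + 1\<close> need
  no case distinction.
\<close>

definition column ::
    "nat \<Rightarrow> (vertex \<Rightarrow> vertex \<Rightarrow> nat) \<Rightarrow> vertex \<Rightarrow> bool \<Rightarrow> vertex set \<Rightarrow> vertex set \<Rightarrow> bool" where
  "column n Q v t P N \<longleftrightarrow>
     (\<forall>u\<in>vertices n. Q u v = of_bool (u \<in> (if t then P else N))
                   \<and> Q v u = of_bool (u \<in> (if t then N else P)))"

text \<open>The product of the cluster over those elements of \<open>S\<close> that are vertices.\<close>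

definition monom :: "nat \<Rightarrow> (vertex \<Rightarrow> ratfun) \<Rightarrow> vertex set \<Rightarrow> ratfun" where
  "monom n c S = (\<Prod>u\<in>vertices n \<inter> S. c u)"

lemma finite_vertices: "finite (vertices n)"
  by (simp add: vertices_def)

lemma vertices_iff [simp]:
  "Mut i \<in> vertices n \<longleftrightarrow> 1 \<le> i \<and> i \<le> n" "Frz i \<in> vertices n \<longleftrightarrow> 1 \<le> i \<and> i \<le> n"
  by (auto simp: vertices_def)

lemma prod_power_of_bool:
  "(\<Prod>u\<in>vertices n. c u ^ of_bool (u \<in> S)) = monom n c S"
proof -
  have "(\<Prod>u\<in>vertices n. c u ^ of_bool (u \<in> S)) = (\<Prod>u\<in>vertices n. if u \<in> S then c u else 1)"
    by (intro prod.cong) auto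
  then show ?thesis
    by (simp add: monom_def prod.inter_restrict finite_vertices)
qed

lemma column_exchange:
  assumes "column n Q v t P N"
  shows "(\<Prod>u\<in>vertices n. c u ^ Q u v) + (\<Prod>u\<in>vertices n. c u ^ Q v u) = monom n c P + monom n c N"
proof -
  have "(\<Prod>u\<in>vertices n. c u ^ Q u v) = monom n c (if t then P else N)"
    using assms by (subst prod_power_of_bool[symmetric], intro prod.cong) (auto simp: column_def)
  moreover have "(\<Prod>u\<in>vertices n. c u ^ Q v u) = monom n c (if t then N else P)"
    using assms by (subst prod_power_of_bool[symmetric], intro prod.cong) (auto simp: column_def)
  ultimately show ?thesis by (simp add: add.commute)
qed

lemma monom_empty [simp]: "monom n c {} = 1"
  by (simp add: monom_def)

lemma monom_insert [simp]:
  "u \<notin> S \<Longrightarrow> monom n c (insert u S) = (if u \<in> vertices n then c u else 1) * monom n c S"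
  by (simp add: monom_def finite_vertices Int_insert_right)

lemma monom_Un: "S \<inter> T = {} \<Longrightarrow> monom n c (S \<union> T) = monom n c S * monom n c T"
  unfolding monom_def Int_Un_distrib
  by (rule prod.union_disjoint) (auto simp: finite_vertices)

text \<open>
  Mutation at a neighbour \<open>w\<close> of \<open>v\<close> moves \<open>w\<close> to the other side of \<open>v\<close> and adds composite
  arrows joining \<open>v\<close> to one side \<open>A\<close> of \<open>w\<close>.  The composite arrows lie on the side of \<open>v\<close> where \<open>w\<close>
  was before, and those to \<open>P\<^sub>0\<close> cancel against existing arrows.
\<close>

lemma column_mutate:
  assumes k: "column n Q w s P N" and v: "column n Q v t P\<^sub>0 N\<^sub>0"
    and w: "w \<in> N\<^sub>0" "w \<in> vertices n" "v \<in> vertices n" "v \<noteq> w" "w \<notin> P\<^sub>0"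
    and A: "A = (if s = t then N else P)" "A \<inter> N\<^sub>0 = {}" "w \<notin> A" "v \<notin> A"
    and disj: "P\<^sub>0 \<inter> N\<^sub>0 = {}"
  shows "column n (mutate_quiver w Q) v t (insert w (P\<^sub>0 - A)) ((N\<^sub>0 - {w}) \<union> (A - P\<^sub>0))"
  unfolding column_def
proof (intro ballI)
  fix u assume u: "u \<in> vertices n"
  have 1: "Q u v = of_bool (u \<in> (if t then P\<^sub>0 else N\<^sub>0))" "Q v u = of_bool (u \<in> (if t then N\<^sub>0 else P\<^sub>0))"
    using v u by (auto simp: column_def)
  have 2: "Q u w = of_bool (u \<in> (if s then P else N))" "Q w u = of_bool (u \<in> (if s then N else P))"
    using k u by (auto simp: column_def)
  have 3: "Q w v = of_bool (\<not> t)" "Q v w = of_bool t"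
    using v w by (auto simp: column_def)
  show "mutate_quiver w Q u v = of_bool (u \<in> (if t then insert w (P\<^sub>0 - A) else N\<^sub>0 - {w} \<union> (A - P\<^sub>0)))
      \<and> mutate_quiver w Q v u = of_bool (u \<in> (if t then N\<^sub>0 - {w} \<union> (A - P\<^sub>0) else insert w (P\<^sub>0 - A)))"
    using w A disj
    by (cases "u = w"; cases s; cases t) (auto simp: mutate_quiver_def 1 2 3)
qed

text \<open>
  The neighbours of \<open>k\<close> just before its mutation, in the sequence of mutations starting at \<open>i\<close>: the
  tail consists of those at position \<open>k + 1\<close>, the head of all others; the sides are named relative
  to the orientation at a descent.  In the initial quiver the heads are \<open>{Frz k}\<close> and
  \<open>{Mut (k - 1)}\<close>, which is the case \<open>k = i\<close>.
\<close>

definition tail_pos :: "nat \<Rightarrow> (nat \<Rightarrow> int) \<Rightarrow> nat \<Rightarrow> vertex set" where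
  "tail_pos n \<xi> k = (if source_or_sink n \<xi> k then {} else {Mut (k + 1)})"

definition tail_neg :: "nat \<Rightarrow> (nat \<Rightarrow> int) \<Rightarrow> nat \<Rightarrow> vertex set" where
  "tail_neg n \<xi> k = (if source_or_sink n \<xi> k then {Mut (k + 1)} else {Frz (k + 1)})"

definition head_pos :: "nat \<Rightarrow> (nat \<Rightarrow> int) \<Rightarrow> nat \<Rightarrow> nat \<Rightarrow> vertex set" where
  "head_pos n \<xi> i k =
     (if k = i then {Frz i}
      else insert (Mut (k - 1)) (if source_or_sink n \<xi> (k - 1) then {Frz k} else {}))"

text \<open>
  By the recursion for $k_\bullet$, this is \<open>head_pos n \<xi> i k\<close> at position \<open>k + 1\<close> if \<open>k\<close> is a
  source or sink, and unchanged from \<open>k\<close> to \<open>k + 1\<close> otherwise.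
\<close>

definition head_neg :: "nat \<Rightarrow> (nat \<Rightarrow> int) \<Rightarrow> nat \<Rightarrow> nat \<Rightarrow> vertex set" where
  "head_neg n \<xi> i k =
     (if bullet n \<xi> k < i then {Mut (i - 1)} else head_pos n \<xi> i (bullet n \<xi> k))"

lemma local_arrows_source_or_sink:
  assumes "2 \<le> n" "1 \<le> i" "i \<le> n"
  shows "local_arrows n \<xi> i =
     {(Mut i, Mut (i - 1)), (Frz i, Mut i)} \<union>
     (if source_or_sink n \<xi> i then {(Mut i, Mut (i + 1))}
      else {(Mut (i + 1), Mut i), (Mut i, Frz (i + 1))})"
  using diamond_eq_iff[OF assms, of \<xi>] by (simp add: local_arrows_def)

lemma height_arrows_eq:
  assumes "height_function n \<xi>" "2 \<le> n" "u \<in> vertices n" "v \<in> vertices n"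
  shows "(u, v) \<in> height_arrows n \<xi> \<longleftrightarrow>
    (\<exists>i. 1 \<le> i \<and> i \<le> n \<and> (if descent n \<xi> i then (u, v) \<in> local_arrows n \<xi> i
                                       else (v, u) \<in> local_arrows n \<xi> i))"
proof -
  have "(u, v) \<in> height_arrows n \<xi> \<longleftrightarrow>
    (\<exists>i. 1 \<le> i \<and> i \<le> n \<and> ((descent n \<xi> i \<and> (u, v) \<in> local_arrows n \<xi> i) \<or>
       (hext n \<xi> i = hext n \<xi> (i + 1) - 1 \<and> (v, u) \<in> local_arrows n \<xi> i)))"
    using assms(3,4) by (auto simp: height_arrows_def descent_def)
  also have "\<dots> \<longleftrightarrow> (\<exists>i. 1 \<le> i \<and> i \<le> n \<and> (if descent n \<xi> i then (u, v) \<in> local_arrows n \<xi> i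
                                       else (v, u) \<in> local_arrows n \<xi> i))"
    using ascent_iff[OF assms(1,2)] by (auto 4 4)
  finally show ?thesis .
qed

text \<open>
  Only \<open>k - 1\<close>, \<open>k\<close> and \<open>k + 1\<close> contribute arrows at \<open>k\<close>, and the turns of the height function
  at \<open>k - 1\<close> and \<open>k\<close> make contributions describing the same edge agree.
\<close>

lemma height_arrows_column:
  assumes hf: "height_function n \<xi>" and n: "2 \<le> n" and k: "1 \<le> k" "k \<le> n" and u: "u \<in> vertices n"
  defines "P \<equiv> insert (Frz k) (tail_pos n \<xi> k)" and "N \<equiv> insert (Mut (k - 1)) (tail_neg n \<xi> k)"
  shows "(u, Mut k) \<in> height_arrows n \<xi> \<longleftrightarrow> u \<in> (if descent n \<xi> k then P else N)"
    and "(Mut k, u) \<in> height_arrows n \<xi> \<longleftrightarrow> u \<in> (if descent n \<xi> k then N else P)"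
proof -
  have v: "Mut k \<in> vertices n" using k by simp
  let ?J = "{i \<in> {k - 1, k, k + 1}. 1 \<le> i \<and> i \<le> n}"
  have adj: "i \<in> ?J" if "1 \<le> i" "i \<le> n" "(u, Mut k) \<in> local_arrows n \<xi> i \<or> (Mut k, u) \<in> local_arrows n \<xi> i" for i
    using that by (auto simp: local_arrows_def split: if_splits)
  have turn: "source_or_sink n \<xi> k \<longleftrightarrow> descent n \<xi> (k + 1) \<noteq> descent n \<xi> k" if "k < n"
    using source_or_sink_iff_turn[OF hf n k(1) that] .
  have turn': "source_or_sink n \<xi> (k - 1) \<longleftrightarrow> descent n \<xi> k \<noteq> descent n \<xi> (k - 1)" if "1 < k"
    using source_or_sink_iff_turn[OF hf n, of "k - 1"] k that by simp
  have sn: "source_or_sink n \<xi> n" using n by (simp add: source_or_sink_def)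
  have J: "?J = (if 1 < k then {k - 1} else {}) \<union> {k} \<union> (if k < n then {k + 1} else {})"
    using k by auto
  note la = local_arrows_source_or_sink[OF n]
  show "(u, Mut k) \<in> height_arrows n \<xi> \<longleftrightarrow> u \<in> (if descent n \<xi> k then P else N)"
  proof -
    have "(u, Mut k) \<in> height_arrows n \<xi> \<longleftrightarrow> (\<exists>i\<in>?J. if descent n \<xi> i then (u, Mut k) \<in> local_arrows n \<xi> i
                                       else (Mut k, u) \<in> local_arrows n \<xi> i)"
      unfolding height_arrows_eq[OF hf n u v] using adj by (smt (verit) mem_Collect_eq)
    also have "\<dots> \<longleftrightarrow> u \<in> (if descent n \<xi> k then P else N)"
      unfolding J P_def N_def using k u turn turn' sn
      by (cases u) (auto simp: la tail_pos_def tail_neg_def split: if_splits)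
    finally show ?thesis .
  qed
  show "(Mut k, u) \<in> height_arrows n \<xi> \<longleftrightarrow> u \<in> (if descent n \<xi> k then N else P)"
  proof -
    have "(Mut k, u) \<in> height_arrows n \<xi> \<longleftrightarrow> (\<exists>i\<in>?J. if descent n \<xi> i then (Mut k, u) \<in> local_arrows n \<xi> i
                                       else (u, Mut k) \<in> local_arrows n \<xi> i)"
      unfolding height_arrows_eq[OF hf n v u] using adj by (smt (verit) mem_Collect_eq)
    also have "\<dots> \<longleftrightarrow> u \<in> (if descent n \<xi> k then N else P)"
      unfolding J P_def N_def using k u turn turn' sn
      by (cases u) (auto simp: la tail_pos_def tail_neg_def split: if_splits)
    finally show ?thesis .
  qed
qed

lemma initial_column:
  assumes "height_function n \<xi>" "2 \<le> n" "1 \<le> k" "k \<le> n"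
  shows "column n (quiver (height_seed n \<xi>)) (Mut k) (descent n \<xi> k)
           (insert (Frz k) (tail_pos n \<xi> k)) (insert (Mut (k - 1)) (tail_neg n \<xi> k))"
  unfolding column_def using height_arrows_column[OF assms] by (simp add: height_seed_def)

section \<open>Mutating along an interval\<close>

text \<open>The seed reached from the initial one by mutating at \<open>i, \<dots>, k - 1\<close>.\<close>

definition seed_at :: "nat \<Rightarrow> (nat \<Rightarrow> int) \<Rightarrow> nat \<Rightarrow> nat \<Rightarrow> seed" where
  "seed_at n \<xi> i k = fold (\<lambda>m. mutate_seed n (Mut m)) [i..<k] (height_seed n \<xi>)"

lemma seed_at_refl [simp]: "seed_at n \<xi> i i = height_seed n \<xi>"
  by (simp add: seed_at_def)

lemma seed_at_Suc: "i \<le> k \<Longrightarrow> seed_at n \<xi> i (Suc k) = mutate_seed n (Mut k) (seed_at n \<xi> i k)"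
  by (simp add: seed_at_def)

lemma x_pos_eq: "i \<le> j \<Longrightarrow> x_pos n \<xi> i j = cluster (seed_at n \<xi> i (Suc j)) (Mut j)"
  by (simp add: x_pos_def seed_at_def)

lemma cluster_mutate_other: "v \<noteq> w \<Longrightarrow> cluster (mutate_seed n w S) v = cluster S v"
  by (simp add: mutate_seed_def)

lemma cluster_seed_at:
  assumes "i \<le> k"
  shows "cluster (seed_at n \<xi> i k) (Mut m) = (if i \<le> m \<and> m < k then x_pos n \<xi> i m else indet (Mut m))"
    and "cluster (seed_at n \<xi> i k) (Frz m) = indet (Frz m)"
  using assms
proof (induction k rule: dec_induct)
  case base
  case 1 show ?case by (auto simp: height_seed_def)
  case 2 show ?case by (simp add: height_seed_def)
next
  case (step k)
  case 1 show ?case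
    using step.IH(1) step.hyps by (cases "m = k") (auto simp: x_pos_eq seed_at_Suc cluster_mutate_other)
  case 2 show ?case
    using step.IH(2) step.hyps by (simp add: seed_at_Suc cluster_mutate_other)
qed

text \<open>Mutations at vertices below \<open>l - 1\<close> do not touch the arrows at \<open>l\<close>.\<close>

lemma later_column_seed_at:
  assumes hf: "height_function n \<xi>" "2 \<le> n" "1 \<le> i" "i \<le> k" "k < l" "l \<le> n"
  shows "column n (quiver (seed_at n \<xi> i k)) (Mut l) (descent n \<xi> l)
           (insert (Frz l) (tail_pos n \<xi> l)) (insert (Mut (l - 1)) (tail_neg n \<xi> l))"
  using assms(4,5)
proof (induction k rule: dec_induct)
  case base
  then show ?case using initial_column[OF hf(1,2), of l] assms by simp
next
  case (step k)
  let ?Q = "quiver (seed_at n \<xi> i k)"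
  have IH: "column n ?Q (Mut l) (descent n \<xi> l)
           (insert (Frz l) (tail_pos n \<xi> l)) (insert (Mut (l - 1)) (tail_neg n \<xi> l))"
    using step by simp
  have "Mut k \<in> vertices n" using step assms by simp
  then have 0: "?Q (Mut k) (Mut l) = 0" "?Q (Mut l) (Mut k) = 0"
    using IH step by (auto simp: column_def tail_pos_def tail_neg_def split: if_splits)
  then have "mutate_quiver (Mut k) ?Q u (Mut l) = ?Q u (Mut l)"
       "mutate_quiver (Mut k) ?Q (Mut l) u = ?Q (Mut l) u" if "u \<in> vertices n" for u
    using that IH step by (auto simp: mutate_quiver_def column_def tail_pos_def tail_neg_def split: if_splits)
  then show ?case
    using IH step.hyps by (simp add: seed_at_Suc mutate_seed_def column_def)
qed

lemma column_seed_at: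
  assumes hf: "height_function n \<xi>" "2 \<le> n" "1 \<le> i" "i \<le> k" "k \<le> n"
  shows "column n (quiver (seed_at n \<xi> i k)) (Mut k) (descent n \<xi> k)
           (head_pos n \<xi> i k \<union> tail_pos n \<xi> k) (head_neg n \<xi> i k \<union> tail_neg n \<xi> k)"
  using assms(4,5)
proof (induction k rule: dec_induct)
  case base
  then show ?case
    using initial_column[OF hf(1,2), of i] assms bullet_less[of n i \<xi>] by (simp add: head_pos_def head_neg_def)
next
  case (step k)
  let ?Q = "quiver (seed_at n \<xi> i k)"
  have k: "1 \<le> k" "k < n" using step assms by auto
  \<comment> \<open>The side of \<open>k\<close> that is handed over to \<open>k + 1\<close>.\<close>
  define A where "A = (if descent n \<xi> k = descent n \<xi> (k + 1)
     then head_neg n \<xi> i k \<union> tail_neg n \<xi> k else head_pos n \<xi> i k \<union> tail_pos n \<xi> k)"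
  have turn: "source_or_sink n \<xi> k \<longleftrightarrow> descent n \<xi> (k + 1) \<noteq> descent n \<xi> k"
    by (rule source_or_sink_iff_turn[OF hf(1,2) k])
  \<comment> \<open>Without a turn at \<open>k\<close> the handed-over \<open>Frz (k + 1)\<close> cancels against the initial arrow
    between \<open>Frz (k + 1)\<close> and \<open>k + 1\<close>.\<close>
  have A: "A = head_neg n \<xi> i (k + 1) \<union> (if source_or_sink n \<xi> k then {} else {Frz (k + 1)})"
    using turn bullet_Suc[OF hf(2) k, of \<xi>] step.hyps
    by (auto simp: A_def head_neg_def tail_pos_def tail_neg_def)
  have head: "head_neg n \<xi> i (k + 1) \<inter> {Mut k, Mut (k + 1), Mut (k + 2), Frz (k + 1), Frz (k + 2)} = {}"
    using bullet_less[OF hf(2), of "k + 1" \<xi>] step.hyps k assms(3)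
    by (auto simp: head_neg_def head_pos_def split: if_splits)
  have 1: "column n ?Q (Mut k) (descent n \<xi> k)
           (head_pos n \<xi> i k \<union> tail_pos n \<xi> k) (head_neg n \<xi> i k \<union> tail_neg n \<xi> k)"
    using step by simp
  have 2: "column n ?Q (Mut (k + 1)) (descent n \<xi> (k + 1))
           (insert (Frz (k + 1)) (tail_pos n \<xi> (k + 1))) (insert (Mut k) (tail_neg n \<xi> (k + 1)))"
    using later_column_seed_at[OF hf(1-3) step.hyps(1), of "k + 1"] k by simp
  have "column n (mutate_quiver (Mut k) ?Q) (Mut (k + 1)) (descent n \<xi> (k + 1))
     (insert (Mut k) (insert (Frz (k + 1)) (tail_pos n \<xi> (k + 1)) - A))
     ((insert (Mut k) (tail_neg n \<xi> (k + 1)) - {Mut k})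
        \<union> (A - insert (Frz (k + 1)) (tail_pos n \<xi> (k + 1))))"
  proof (rule column_mutate[OF 1 2 _ _ _ _ _ A_def])
    show "A \<inter> insert (Mut k) (tail_neg n \<xi> (k + 1)) = {}" "Mut k \<notin> A" "Mut (k + 1) \<notin> A"
      using head by (auto simp: A tail_neg_def)
  qed (use k in \<open>auto simp: tail_pos_def tail_neg_def\<close>)
  moreover have "insert (Mut k) (insert (Frz (k + 1)) (tail_pos n \<xi> (k + 1)) - A) =
      head_pos n \<xi> i (k + 1) \<union> tail_pos n \<xi> (k + 1)"
    using head step.hyps by (auto simp: A head_pos_def tail_pos_def)
  moreover have "(insert (Mut k) (tail_neg n \<xi> (k + 1)) - {Mut k})
        \<union> (A - insert (Frz (k + 1)) (tail_pos n \<xi> (k + 1))) =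
      head_neg n \<xi> i (k + 1) \<union> tail_neg n \<xi> (k + 1)"
    using head by (auto simp: A tail_pos_def tail_neg_def)
  ultimately show ?case
    using step.hyps by (simp add: seed_at_Suc mutate_seed_def)
qed

section \<open>Exchange relations\<close>

text \<open>
  The monomials of the two heads in the cluster variables: $H_k$ and $F_k$ in the notation above.
\<close>

definition x_head_pos :: "nat \<Rightarrow> (nat \<Rightarrow> int) \<Rightarrow> nat \<Rightarrow> nat \<Rightarrow> ratfun" where
  "x_head_pos n \<xi> i k =
     (if k = i then x_frz n i else x_pos n \<xi> i (k - 1) * x_frz n k ^ d_ind n \<xi> (k - 1))"

definition x_head_neg :: "nat \<Rightarrow> (nat \<Rightarrow> int) \<Rightarrow> nat \<Rightarrow> nat \<Rightarrow> ratfun" where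
  "x_head_neg n \<xi> i k =
     (if bullet n \<xi> k < i then x_neg n (i - 1) else x_head_pos n \<xi> i (bullet n \<xi> k))"

lemma monom_head_pos:
  assumes "2 \<le> n" "1 \<le> i" "i \<le> m" "m \<le> k" "k \<le> n"
  shows "monom n (cluster (seed_at n \<xi> i k)) (head_pos n \<xi> i m) = x_head_pos n \<xi> i m"
  using assms cluster_seed_at[of i k n \<xi>] d_ind_eq[of n "m - 1" \<xi>]
  by (auto simp: head_pos_def x_head_pos_def x_frz_def)

lemma monom_head_neg:
  assumes "2 \<le> n" "1 \<le> i" "i \<le> k" "k \<le> n"
  shows "monom n (cluster (seed_at n \<xi> i k)) (head_neg n \<xi> i k) = x_head_neg n \<xi> i k"
  using assms cluster_seed_at[of i k n \<xi>] monom_head_pos[of n i "bullet n \<xi> k" k \<xi>] bullet_less[of n k \<xi>]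
  by (auto simp: head_neg_def x_head_neg_def x_neg_def)

lemma monom_tail:
  assumes "2 \<le> n" "1 \<le> i" "i \<le> k" "k \<le> n"
  shows "monom n (cluster (seed_at n \<xi> i k)) (tail_pos n \<xi> k) = x_neg n (k + 1) ^ (1 - d_ind n \<xi> k)"
    and "monom n (cluster (seed_at n \<xi> i k)) (tail_neg n \<xi> k)
           = x_neg n (k + 1) ^ d_ind n \<xi> k * x_frz n (k + 1) ^ (1 - d_ind n \<xi> k)"
  using assms cluster_seed_at[of i k n \<xi>] d_ind_eq[of n k \<xi>]
  by (auto simp: tail_pos_def tail_neg_def x_neg_def x_frz_def)

lemma indet_nonzero: "indet v \<noteq> 0"
  proof -
  have "Poly_Mapping.single (Poly_Mapping.single v (1 :: nat)) (1 :: rat) \<noteq> 0"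
    by (metis lookup_single_eq lookup_zero one_neq_zero)
  then show ?thesis unfolding indet_def Zero_fract_def by (subst eq_fract) auto
qed

lemma exchange_relation:
  assumes hf: "height_function n \<xi>" "2 \<le> n" "1 \<le> i" "i \<le> k" "k \<le> n"
  shows "x_pos n \<xi> i k * x_neg n k =
     x_head_pos n \<xi> i k * x_neg n (k + 1) ^ (1 - d_ind n \<xi> k)
     + x_head_neg n \<xi> i k * x_neg n (k + 1) ^ d_ind n \<xi> k * x_frz n (k + 1) ^ (1 - d_ind n \<xi> k)"
proof -
  let ?S = "seed_at n \<xi> i k"
  have b: "bullet n \<xi> k < k" using bullet_less assms by simp
  have disj: "head_pos n \<xi> i k \<inter> tail_pos n \<xi> k = {}" "head_neg n \<xi> i k \<inter> tail_neg n \<xi> k = {}"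
    using assms b by (auto simp: head_pos_def tail_pos_def head_neg_def tail_neg_def split: if_splits)
  have xk: "cluster ?S (Mut k) = x_neg n k"
    using assms cluster_seed_at(1)[of i k n \<xi> k] by (simp add: x_neg_def)
  have "x_pos n \<xi> i k = (monom n (cluster ?S) (head_pos n \<xi> i k \<union> tail_pos n \<xi> k)
       + monom n (cluster ?S) (head_neg n \<xi> i k \<union> tail_neg n \<xi> k)) / x_neg n k"
    using assms column_exchange[OF column_seed_at[OF assms], of "cluster ?S"] xk
    by (simp add: x_pos_eq seed_at_Suc mutate_seed_def)
  moreover have "x_neg n k \<noteq> 0"
    using assms indet_nonzero by (simp add: x_neg_def)
  ultimately show ?thesis
    using assms by (simp add: monom_Un disj monom_head_pos monom_head_neg monom_tail mult.assoc)
qed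

section \<open>The product of $x[\alpha_{i,j}]$ and $x[\alpha_{j+1,j+1}]$\<close>

lemma seed_at_mutation_class:
  assumes "1 \<le> i" "i \<le> k" "k \<le> n + 1"
  shows "seed_at n \<xi> i k \<in> mutation_class n (height_seed n \<xi>)"
  using assms(2,3)
proof (induction k rule: dec_induct)
  case base
  show ?case by (simp add: mutation_class.initial)
next
  case (step k)
  then show ?case using assms(1) by (simp add: seed_at_Suc mutation_class.mutate)
qed

lemma x_pos_in_cluster_algebra:
  assumes "1 \<le> i" "i \<le> j" "j \<le> n"
  shows "x_pos n \<xi> i j \<in> cluster_algebra n (height_seed n \<xi>)"
  using assms seed_at_mutation_class[of i "Suc j" n \<xi>]
  by (simp add: x_pos_eq cluster_algebra.generator)

lemma x_head_neg_eq:
  assumes "2 \<le> n" "1 \<le> i" "i < j" "j \<le> n"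
  shows "x_head_neg n \<xi> i j =
     x_pos n \<xi> i (max (i - 1) (bullet n \<xi> j - 1)) ^ (1 - kdelta i (bullet n \<xi> j))
        * x_frz n (max i (bullet n \<xi> j))
            ^ min 1 ((1 - kdelta (bullet n \<xi> j) (bullet n \<xi> i)) * d_ind n \<xi> (bullet n \<xi> j - 1)
                     + kdelta (bullet n \<xi> j) i)"
proof -
  consider "bullet n \<xi> j < i" | "bullet n \<xi> j = i" | "i < bullet n \<xi> j" by linarith
  then show ?thesis
  proof cases
    case 1
    then have "bullet n \<xi> j = bullet n \<xi> i" using bullet_eq_if_less[of n i j \<xi>] assms by simp
    moreover have "max (i - 1) (bullet n \<xi> j - 1) = i - 1" using 1 by simp
    ultimately show ?thesis using 1 assms by (simp add: x_head_neg_def kdelta_def x_pos_def)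
  next
    case 2
    then show ?thesis by (simp add: x_head_neg_def x_head_pos_def kdelta_def)
  next
    case 3
    then have "bullet n \<xi> j \<noteq> bullet n \<xi> i" using bullet_less[of n i \<xi>] assms by simp
    moreover have "min 1 (d_ind n \<xi> m) = d_ind n \<xi> m" for m by (simp add: d_ind_def kdelta_def)
    ultimately show ?thesis using 3 by (simp add: x_head_neg_def x_head_pos_def kdelta_def)
  qed
qed

theorem theorem1p3:
  fixes n i j :: nat and \<xi> :: "nat \<Rightarrow> int"
  assumes "height_function n \<xi>"
    and "j \<in> {1..n}" and "j < n" and "source_or_sink n \<xi> j"
    and "i \<in> {1..n}" and "i < j"
  shows "x_pos n \<xi> i j * x_pos n \<xi> (j + 1) (j + 1) \<in> cluster_algebra n (height_seed n \<xi>) \<and>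
    x_pos n \<xi> i j * x_pos n \<xi> (j + 1) (j + 1) =
      x_pos n \<xi> i (j + 1)
      + x_pos n \<xi> i (max (i - 1) (bullet n \<xi> j - 1)) ^ (1 - kdelta i (bullet n \<xi> j))
        * x_frz n (max i (bullet n \<xi> j))
            ^ min 1 ((1 - kdelta (bullet n \<xi> j) (bullet n \<xi> i)) * d_ind n \<xi> (bullet n \<xi> j - 1)
                     + kdelta (bullet n \<xi> j) i)
        * x_neg n (j + 2) ^ d_ind n \<xi> (j + 1)
        * x_frz n (j + 2) ^ (1 - d_ind n \<xi> (j + 1))"
proof (intro conjI)
  have n: "2 \<le> n" and ij: "1 \<le> i" "1 \<le> j" using assms by auto
  show "x_pos n \<xi> i j * x_pos n \<xi> (j + 1) (j + 1) \<in> cluster_algebra n (height_seed n \<xi>)"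
    using assms by (intro cluster_algebra.mult x_pos_in_cluster_algebra) auto
  define X Y Z F p q x where "X = x_pos n \<xi> i j" and "Y = x_pos n \<xi> (j + 1) (j + 1)"
    and "Z = x_pos n \<xi> i (j + 1)" and "F = x_head_neg n \<xi> i j"
    and "p = x_neg n (j + 2) ^ (1 - d_ind n \<xi> (j + 1))"
    and "q = x_neg n (j + 2) ^ d_ind n \<xi> (j + 1) * x_frz n (j + 2) ^ (1 - d_ind n \<xi> (j + 1))"
    and "x = x_neg n (j + 1)"
  define H where "H = x_head_pos n \<xi> i j"
  have dj: "d_ind n \<xi> j = 1" using d_ind_eq[of n j \<xi>] n assms by simp
  have b: "bullet n \<xi> (j + 1) = j" using bullet_Suc[of n j \<xi>] n assms by simp
  have eX: "X * x_neg n j = H + F * x"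
    using exchange_relation[OF assms(1) n ij(1), of j] assms dj
    by (simp add: X_def H_def F_def x_def)
  have eZ: "Z * x = X * x_frz n (j + 1) * p + H * q"
    using exchange_relation[OF assms(1) n ij(1), of "j + 1"] assms dj b
    by (simp add: X_def Z_def H_def p_def q_def x_def x_head_pos_def x_head_neg_def mult.assoc)
  have eY: "Y * x = x_frz n (j + 1) * p + x_neg n j * q"
    using exchange_relation[OF assms(1) n, of "j + 1" "j + 1"] assms b
    by (simp add: Y_def p_def q_def x_def x_head_pos_def x_head_neg_def mult.assoc)
  have "x \<noteq> 0" using assms indet_nonzero by (simp add: x_def x_neg_def)
  have "(X * Y) * x = X * (x_frz n (j + 1) * p) + (X * x_neg n j) * q"
    unfolding mult.assoc eY by (simp add: algebra_simps)
  also have "\<dots> = (Z + F * q) * x"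
    unfolding eX by (simp add: algebra_simps eZ)
  finally have "X * Y = Z + F * q" using \<open>x \<noteq> 0\<close> by simp
  then show "x_pos n \<xi> i j * x_pos n \<xi> (j + 1) (j + 1) =
      x_pos n \<xi> i (j + 1)
      + x_pos n \<xi> i (max (i - 1) (bullet n \<xi> j - 1)) ^ (1 - kdelta i (bullet n \<xi> j))
        * x_frz n (max i (bullet n \<xi> j))
            ^ min 1 ((1 - kdelta (bullet n \<xi> j) (bullet n \<xi> i)) * d_ind n \<xi> (bullet n \<xi> j - 1)
                     + kdelta (bullet n \<xi> j) i)
        * x_neg n (j + 2) ^ d_ind n \<xi> (j + 1)
        * x_frz n (j + 2) ^ (1 - d_ind n \<xi> (j + 1))"
    using x_head_neg_eq[OF n ij(1) assms(6), of \<xi>] assms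
    by (simp add: X_def Y_def Z_def F_def q_def mult.assoc)
qed

end
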